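(* For any unit interval graph $G$ (given online as a sequence of unit intervals), the number of colors used by the Kierstead-Trotter algorithm is at most $3\omega(G)-3$, where $\omega(G)$ is the size of a maximum clique in $G$.
   Context: Online unit interval coloring: closed intervals of length one on the real line are revealed one at a time, $v_i$ being the $i$th interval; $G=(V,E)$ is the interval graph whose vertices are the intervals, two intervals being adjacent iff they intersect. Each interval must be assigned a color upon arrival, before the next is revealed, so that intersecting intervals get different colors. For a graph $H$ and vertex $v$ of $H$, $\omega(H,v)$ denotes the size of a maximum clique of $H$ containing $v$. Kierstead-Trotter algorithm: every interval $v$ has a level $\ell(v)$, initialized to $1$. For integers $x\le y$ let $V_{x,y}(i)=\{v_j : j\le i,\ x\le \ell(v_j)\le y\}$ and $G_{x,y}(i)$ the subgraph of $G$ induced by $V_{x,y}(i)$. When $v_i$ is revealed: (Step 1) set $\ell(v_i)$ to the smallest positive integer $j$ with $\omega(G_{1,j}(i),v_i)\le j$ (where $v_i$ currently has level $1$ and so belongs to $G_{1,j}(i)$); (Step 2) color $v_i$ by First-Fit on $G_{\ell(v_i),\ell(v_i)}(i)$ using the palette $P_{\ell(v_i)}$, i.e., give $v_i$ the first color in a fixed ordering of $P_{\ell(v_i)}$ not already used by an earlier interval of the same level intersecting $v_i$. The palettes $P_1,P_2,\dots$ are pairwise disjoint sets of colors.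
   Formalization: The formal theorem additionally assumes ω(G) ≥ 2; for ω(G) = 1 the stated bound is 0 while at least one color is used, and for the empty graph the bound is −3, so the claim fails exactly in those cases. *)

theory Defs
  imports Complex_Main "HOL-Library.Ramsey" "HOL-Library.Disjoint_Sets"
begin

type_synonym 'a graph = "'a set \<times> 'a set set"

definition induced :: "'a graph \<Rightarrow> 'a set \<Rightarrow> 'a graph" where
  "induced H W = (fst H \<inter> W, {e \<in> snd H. e \<subseteq> W})"

definition cliques :: "'a graph \<Rightarrow> 'a set set" where
  "cliques H = {K. K \<subseteq> fst H \<and> clique K (snd H)}"

definition clique_number :: "'a graph \<Rightarrow> nat" where
  "clique_number H = Max (card ` cliques H)"

definition clique_number_at :: "'a graph \<Rightarrow> 'a \<Rightarrow> nat" where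
  "clique_number_at H v = Max (card ` {K \<in> cliques H. v \<in> K})"

definition unit_interval :: "real set \<Rightarrow> bool" where
  "unit_interval I \<longleftrightarrow> (\<exists>a. I = {a..a + 1})"

(* A vertex is the arrival index of an interval, counted from 1, so the same
   interval may be presented several times. *)
definition interval_graph :: "(nat \<Rightarrow> real set) \<Rightarrow> nat \<Rightarrow> nat graph" where
  "interval_graph v n =
     ({1..n}, {{i, j} |i j. i \<in> {1..n} \<and> j \<in> {1..n} \<and> i \<noteq> j \<and> v i \<inter> v j \<noteq> {}})"

(* V_{x,y}(i) and G_{x,y}(i), for a given assignment lev of levels. *)
definition level_verts :: "(nat \<Rightarrow> nat) \<Rightarrow> nat \<Rightarrow> nat \<Rightarrow> nat \<Rightarrow> nat set" where
  "level_verts lev x y i = {j \<in> {1..i}. x \<le> lev j \<and> lev j \<le> y}"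

definition level_graph ::
  "(nat \<Rightarrow> real set) \<Rightarrow> (nat \<Rightarrow> nat) \<Rightarrow> nat \<Rightarrow> nat \<Rightarrow> nat \<Rightarrow> nat graph" where
  "level_graph v lev x y i = induced (interval_graph v i) (level_verts lev x y i)"

definition kt_level :: "(nat \<Rightarrow> real set) \<Rightarrow> (nat \<Rightarrow> nat) \<Rightarrow> nat \<Rightarrow> nat" where
  "kt_level v lev i =
     (LEAST j. 1 \<le> j \<and> clique_number_at (level_graph v lev 1 j i) i \<le> j)"

(* pal l enumerates the palette P_l in its fixed order. The enumeration is
   infinite, so that First-Fit never runs out of colors. *)
definition palettes :: "(nat \<Rightarrow> nat \<Rightarrow> 'c) \<Rightarrow> bool" where
  "palettes pal \<longleftrightarrow>
     (\<forall>l\<ge>1. inj (pal l)) \<and> disjoint_family_on (\<lambda>l. range (pal l)) {1..}"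

definition first_fit :: "nat graph \<Rightarrow> (nat \<Rightarrow> 'c) \<Rightarrow> (nat \<Rightarrow> 'c) \<Rightarrow> nat \<Rightarrow> 'c" where
  "first_fit H p col i =
     p (LEAST k. \<forall>j \<in> fst H. j < i \<and> {j, i} \<in> snd H \<longrightarrow> col j \<noteq> p k)"

(* Levels and colors after the first i intervals have been processed. Intervals
   not yet revealed have the initial level 1 and no meaningful color. *)
primrec kt_state ::
  "(nat \<Rightarrow> nat \<Rightarrow> 'c) \<Rightarrow> (nat \<Rightarrow> real set) \<Rightarrow> nat \<Rightarrow> (nat \<Rightarrow> nat) \<times> (nat \<Rightarrow> 'c)" where
  "kt_state pal v 0 = (\<lambda>_. 1, \<lambda>_. undefined)"
| "kt_state pal v (Suc i) =
     (let (lev, col) = kt_state pal v i;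
          l = kt_level v lev (Suc i);
          lev' = lev(Suc i := l)
      in (lev', col(Suc i := first_fit (level_graph v lev' l l (Suc i)) (pal l) col (Suc i))))"

definition kt_colors_used :: "(nat \<Rightarrow> nat \<Rightarrow> 'c) \<Rightarrow> (nat \<Rightarrow> real set) \<Rightarrow> nat \<Rightarrow> 'c set" where
  "kt_colors_used pal v n = snd (kt_state pal v n) ` {1..n}"

end

(* An interval of level l >= 2 contains a point covered by l - 1 earlier intervals of lower
   levels, and no other interval of level l covers that point. Unit intervals with such private
   points have at most one neighbour of their own level on each side, so First-Fit uses at most
   three colors on a level. Level 1 is an independent set and needs one color. On level 2 an
   arriving interval cannot have earlier neighbours on both sides: the level 1 interval through
   its private point would meet one of them and give a triangle. With levels bounded by omega,
   the total is at most 1 + 2 + 3 (omega - 2). *)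
theory Submission
  imports Defs
begin

section \<open>Levels and cliques\<close>

text \<open>Read off right after \<open>i\<close> arrives. Step \<open>i\<close> alone writes entry
  \<open>i\<close>, so all later states agree. Index 0 keeps the initial level 1.\<close>

definition final_level :: "(nat \<Rightarrow> nat \<Rightarrow> 'c) \<Rightarrow> (nat \<Rightarrow> real set) \<Rightarrow> nat \<Rightarrow> nat" where
  "final_level pal v i = fst (kt_state pal v i) i"

definition final_color :: "(nat \<Rightarrow> nat \<Rightarrow> 'c) \<Rightarrow> (nat \<Rightarrow> real set) \<Rightarrow> nat \<Rightarrow> 'c" where
  "final_color pal v i = snd (kt_state pal v i) i"

abbreviation (input) meeting :: "(nat \<Rightarrow> real set) \<Rightarrow> nat set \<Rightarrow> bool" where
  "meeting v \<equiv> pairwise (\<lambda>j k. v j \<inter> v k \<noteq> {})"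

lemma fst_kt_state:
  "fst (kt_state pal v m) j = (if j \<le> m then final_level pal v j else 1)"
proof (induction m)
  case 0
  then show ?case by (simp add: final_level_def)
next
  case (Suc m)
  then show ?case
    by (cases "j = Suc m") (auto simp: final_level_def Let_def split_beta)
qed

lemma snd_kt_state:
  "j \<le> m \<Longrightarrow> snd (kt_state pal v m) j = final_color pal v j"
proof (induction m)
  case 0
  then show ?case by (simp add: final_color_def)
next
  case (Suc m)
  then show ?case
    by (cases "j = Suc m") (auto simp: final_color_def Let_def split_beta)
qed

section \<open>Cliques as sets of pairwise intersecting intervals\<close>

lemma interval_graph_edge:
  "{j, k} \<in> snd (interval_graph v i) \<longleftrightarrow>
     j \<in> {1..i} \<and> k \<in> {1..i} \<and> j \<noteq> k \<and> v j \<inter> v k \<noteq> {}"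
  by (auto simp: interval_graph_def doubleton_eq_iff Int_commute)

lemma level_graph_edge:
  "{j, k} \<in> snd (level_graph v lev x y i) \<longleftrightarrow>
     j \<in> level_verts lev x y i \<and> k \<in> level_verts lev x y i \<and> j \<noteq> k \<and> v j \<inter> v k \<noteq> {}"
proof -
  have "{j, k} \<in> snd (level_graph v lev x y i) \<longleftrightarrow>
      {j, k} \<in> snd (interval_graph v i) \<and> {j, k} \<subseteq> level_verts lev x y i"
    by (simp add: level_graph_def induced_def)
  then show ?thesis
    by (auto simp: interval_graph_edge level_verts_def)
qed

lemma fst_level_graph: "fst (level_graph v lev x y i) = level_verts lev x y i"
  by (auto simp: level_graph_def induced_def interval_graph_def level_verts_def)

lemma cliques_interval_graph:
  "K \<in> cliques (interval_graph v i) \<longleftrightarrow> K \<subseteq> {1..i} \<and> meeting v K"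
proof -
  have "fst (interval_graph v i) = {1..i}"
    by (simp add: interval_graph_def)
  then show ?thesis
    unfolding cliques_def clique_def pairwise_def mem_Collect_eq interval_graph_edge by blast
qed

lemma finite_cliques_interval_graph: "finite (cliques (interval_graph v i))"
  by (rule finite_subset[of _ "Pow {1..i}"]) (use cliques_interval_graph in blast)+

lemma cliques_level_graph:
  "K \<in> cliques (level_graph v lev x y i) \<longleftrightarrow> K \<subseteq> level_verts lev x y i \<and> meeting v K"
  unfolding cliques_def clique_def pairwise_def mem_Collect_eq level_graph_edge fst_level_graph
  by blast

lemma finite_cliques_level_graph: "finite (cliques (level_graph v lev x y i))"
  by (rule finite_subset[of _ "Pow {1..i}"])
    (auto simp: cliques_level_graph level_verts_def)

lemma card_le_clique_number_at:
  assumes "K \<subseteq> level_verts lev x y i" "meeting v K" "i \<in> K"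
  shows "card K \<le> clique_number_at (level_graph v lev x y i) i"
  unfolding clique_number_at_def using assms
  by (intro Max_ge finite_imageI imageI)
    (auto simp: cliques_level_graph intro: finite_subset[OF _ finite_cliques_level_graph])

lemma clique_number_at_attained:
  assumes "i \<in> level_verts lev x y i"
  obtains K where "K \<subseteq> level_verts lev x y i" "meeting v K" "i \<in> K"
    "clique_number_at (level_graph v lev x y i) i = card K"
proof -
  let ?C = "{K \<in> cliques (level_graph v lev x y i). i \<in> K}"
  have "{i} \<in> ?C"
    using assms by (simp add: cliques_level_graph)
  moreover have "finite ?C"
    by (rule finite_subset[OF _ finite_cliques_level_graph]) auto
  ultimately have "Max (card ` ?C) \<in> card ` ?C"
    by (intro Max_in) auto
  then show ?thesis
    using that unfolding clique_number_at_def by (auto simp: cliques_level_graph)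
qed

lemma card_le_clique_number:
  assumes "K \<subseteq> {1..n}" "meeting v K"
  shows "card K \<le> clique_number (interval_graph v n)"
  unfolding clique_number_def
proof (rule Max_ge)
  show "finite (card ` cliques (interval_graph v n))"
    by (intro finite_imageI finite_cliques_interval_graph)
  show "card K \<in> card ` cliques (interval_graph v n)"
    using assms by (auto simp: cliques_interval_graph)
qed

section \<open>Consequences of the choice of level\<close>

lemma final_level_Suc:
  "final_level pal v (Suc m) = kt_level v (fst (kt_state pal v m)) (Suc m)"
  by (simp add: final_level_def Let_def split_beta)

lemma arriving_level_verts:
  assumes "1 \<le> j"
  shows "Suc m \<in> level_verts (fst (kt_state pal v m)) 1 j (Suc m)"
  using assms by (simp add: level_verts_def fst_kt_state)

text \<open>Cliques of an induced subgraph are cliques of the whole graph. The witness serves twice: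
  the \<open>LEAST\<close> in \<open>kt_level\<close> is attained, and it is bounded.\<close>

lemma arriving_admissible:
  "1 \<le> clique_number (interval_graph v (Suc m)) \<and>
   clique_number_at (level_graph v (fst (kt_state pal v m)) 1
     (clique_number (interval_graph v (Suc m))) (Suc m)) (Suc m)
     \<le> clique_number (interval_graph v (Suc m))"
proof -
  let ?w = "clique_number (interval_graph v (Suc m))"
  have "card {Suc m} \<le> ?w"
    by (rule card_le_clique_number) auto
  then have w: "1 \<le> ?w" by simp
  obtain K where K: "K \<subseteq> level_verts (fst (kt_state pal v m)) 1 ?w (Suc m)" "meeting v K"
    "clique_number_at (level_graph v (fst (kt_state pal v m)) 1 ?w (Suc m)) (Suc m) = card K"
    by (rule clique_number_at_attained[OF arriving_level_verts[OF w]])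
  moreover have "card K \<le> ?w"
    using K(1,2) by (intro card_le_clique_number) (auto simp: level_verts_def)
  ultimately show ?thesis
    using w by simp
qed

lemma final_level_admissible:
  "1 \<le> final_level pal v (Suc m) \<and>
   clique_number_at (level_graph v (fst (kt_state pal v m)) 1
     (final_level pal v (Suc m)) (Suc m)) (Suc m) \<le> final_level pal v (Suc m)"
  unfolding final_level_Suc kt_level_def by (rule LeastI, rule arriving_admissible)

lemma final_level_pos: "1 \<le> final_level pal v i"
  using final_level_admissible by (cases i) (auto simp: final_level_def)

text \<open>The level is at most the clique number at arrival, and cliques persist as the graph
  grows.\<close>

lemma final_level_le_clique_number:
  assumes "i \<in> {1..n}"
  shows "final_level pal v i \<le> clique_number (interval_graph v n)"
proof -
  obtain m where m: "i = Suc m"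
    using assms by (cases i) auto
  let ?C = "cliques (interval_graph v i)"
  have "final_level pal v i \<le> clique_number (interval_graph v i)"
    unfolding m final_level_Suc kt_level_def by (rule Least_le, rule arriving_admissible)
  also have "\<dots> \<le> clique_number (interval_graph v n)"
    unfolding clique_number_def[of "interval_graph v i"]
  proof (rule Max.boundedI)
    show "finite (card ` ?C)"
      by (intro finite_imageI finite_cliques_interval_graph)
    show "card ` ?C \<noteq> {}"
      using cliques_interval_graph[of "{}" v i] by auto
    fix c assume "c \<in> card ` ?C"
    then obtain K where "c = card K" "K \<subseteq> {1..i}" "meeting v K"
      by (auto simp: cliques_interval_graph)
    moreover from this have "K \<subseteq> {1..n}"
      using assms by fastforce
    ultimately show "c \<le> clique_number (interval_graph v n)"
      using card_le_clique_number by blast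
  qed
  finally show ?thesis .
qed

text \<open>Since \<open>i\<close> arrives last in \<open>K\<close>, the other members already had
  their final levels, so \<open>K\<close> is among the cliques that were tested when
  \<open>i\<close> received its level.\<close>

lemma meeting_card_le_final_level:
  assumes K: "K \<subseteq> {1..i}" "i \<in> K" "meeting v K"
    and lev: "\<And>k. k \<in> K \<Longrightarrow> final_level pal v k \<le> final_level pal v i"
  shows "card K \<le> final_level pal v i"
proof -
  obtain m where m: "i = Suc m"
    using K by (cases i) auto
  \<comment> \<open>The test uses the state before step \<open>i\<close>, in which \<open>i\<close>
    still has level 1 and is therefore included.\<close>
  have "K \<subseteq> level_verts (fst (kt_state pal v m)) 1 (final_level pal v i) i"
    using K(1) lev final_level_pos[of pal v] m by (auto simp: level_verts_def fst_kt_state)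
  from card_le_clique_number_at[OF this K(3,2)] show ?thesis
    using final_level_admissible[of pal v m] m by simp
qed

text \<open>By minimality the level just below that of \<open>i\<close> fails the test, which yields
  a clique through \<open>i\<close> one larger than that lower level; \<open>K\<close> is this
  clique without \<open>i\<close>.\<close>

lemma lower_level_clique:
  assumes "1 \<le> i" "2 \<le> final_level pal v i"
  obtains K where "K \<subseteq> {1..<i}" "meeting v (insert i K)"
    "\<And>k. k \<in> K \<Longrightarrow> final_level pal v k < final_level pal v i"
    "final_level pal v i \<le> card K + 1"
proof -
  obtain m where m: "i = Suc m"
    using assms by (cases i) auto
  let ?l = "final_level pal v i"
  let ?lev = "fst (kt_state pal v m)"
  \<comment> \<open>The \<open>LEAST\<close> ranges over positive levels, so \<open>?l - 1\<close>
    counts as a rejected candidate only if it is positive.\<close>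
  have l1: "1 \<le> ?l - 1" using assms by simp
  have "\<not> clique_number_at (level_graph v ?lev 1 (?l - 1) i) i \<le> ?l - 1"
    using not_less_Least[of "?l - 1"
        "\<lambda>j. 1 \<le> j \<and> clique_number_at (level_graph v ?lev 1 j i) i \<le> j"] l1
    unfolding m final_level_Suc kt_level_def by auto
  moreover obtain K where K: "K \<subseteq> level_verts ?lev 1 (?l - 1) i" "meeting v K" "i \<in> K"
    "clique_number_at (level_graph v ?lev 1 (?l - 1) i) i = card K"
    using clique_number_at_attained[OF arriving_level_verts[OF l1, of m pal v]] m by metis
  ultimately have "?l \<le> card K" by linarith
  moreover have "finite K"
    using K(1) by (rule finite_subset) (simp add: level_verts_def)
  ultimately have "?l \<le> card (K - {i}) + 1"
    using K(3) by (simp add: card_Diff_singleton)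
  \<comment> \<open>Apart from \<open>i\<close> with its provisional level 1, the members of
    \<open>K\<close> carry their final levels in this state.\<close>
  moreover have "final_level pal v k < ?l" if "k \<in> K - {i}" for k
    using that K(1) m l1 by (auto simp: level_verts_def fst_kt_state split: if_splits)
  moreover have "K - {i} \<subseteq> {1..<i}"
    using K(1) by (auto simp: level_verts_def)
  moreover have "meeting v (insert i (K - {i}))"
    using K(2,3) by (simp add: insert_absorb)
  ultimately show ?thesis using that by blast
qed

section \<open>Private points and neighbours of the same level\<close>

text \<open>The intervals whose colors First-Fit has to avoid at \<open>i\<close>.\<close>

definition earlier_neighbours ::
  "(nat \<Rightarrow> nat \<Rightarrow> 'c) \<Rightarrow> (nat \<Rightarrow> real set) \<Rightarrow> nat \<Rightarrow> nat set" where
  "earlier_neighbours pal v i =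
     {u \<in> {1..<i}. final_level pal v u = final_level pal v i \<and> v u \<inter> v i \<noteq> {}}"

lemma finite_earlier_neighbours: "finite (earlier_neighbours pal v i)"
  by (simp add: earlier_neighbours_def)

text \<open>Two intersecting intervals of level 1 form a clique of size 2, which the test at the
  later arrival excludes.\<close>

lemma earlier_neighbours_level_1:
  assumes "final_level pal v i = 1"
  shows "earlier_neighbours pal v i = {}"
proof (rule ccontr)
  assume "earlier_neighbours pal v i \<noteq> {}"
  then obtain u where u: "u \<in> {1..<i}" "final_level pal v u = 1" "v u \<inter> v i \<noteq> {}"
    using assms by (auto simp: earlier_neighbours_def)
  have "card {u, i} \<le> final_level pal v i"
    using u assms
    by (intro meeting_card_le_final_level) (auto simp: pairwise_insert Int_commute)
  then show False using u assms by simp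
qed

section \<open>Geometry of unit intervals with left endpoints \<open>a i\<close>\<close>

context
  fixes pal :: "nat \<Rightarrow> nat \<Rightarrow> 'c" and v :: "nat \<Rightarrow> real set" and n :: nat and a :: "nat \<Rightarrow> real"
  assumes unit: "\<And>i. i \<in> {1..n} \<Longrightarrow> v i = {a i..a i + 1}"
begin

lemma unit_meet:
  assumes "i \<in> {1..n}" "j \<in> {1..n}"
  shows "v i \<inter> v j \<noteq> {} \<longleftrightarrow> \<bar>a i - a j\<bar> \<le> 1"
  using assms by (auto simp: unit)

text \<open>Helly's theorem on the line: the largest left endpoint lies in every interval.\<close>

lemma common_point:
  assumes "K \<subseteq> {1..n}" "K \<noteq> {}" "meeting v K"
  obtains p where "\<And>k. k \<in> K \<Longrightarrow> p \<in> v k"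
proof -
  have fin: "finite K" using assms(1) finite_subset by blast
  have "Max (a ` K) \<in> a ` K"
    using fin assms(2) by (intro Max_in) auto
  then obtain m where m: "m \<in> K" "a m = Max (a ` K)" by fastforce
  have "a m \<in> v k" if k: "k \<in> K" for k
  proof -
    have n: "m \<in> {1..n}" "k \<in> {1..n}"
      using assms(1) m(1) k by blast+
    have "a k \<le> a m" using m fin k by simp
    moreover have "\<bar>a m - a k\<bar> \<le> 1"
      using unit_meet[OF n] pairwiseD[OF assms(3) m(1) k] by (cases "m = k") simp_all
    ultimately show ?thesis by (simp add: unit[OF n(2)])
  qed
  then show ?thesis using that by blast
qed

text \<open>Take \<open>p\<close> common to \<open>i\<close> and its clique \<open>K\<close> of
  lower levels. A second interval of the same level through \<open>p\<close> would enlarge the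
  clique beyond that level.\<close>

lemma private_point:
  assumes i: "i \<in> {1..n}" "2 \<le> final_level pal v i"
  obtains p K where "p \<in> v i" "K \<subseteq> {1..<i}" "K \<noteq> {}"
    "\<And>k. k \<in> K \<Longrightarrow> p \<in> v k"
    "\<And>k. k \<in> K \<Longrightarrow> final_level pal v k < final_level pal v i"
    "\<And>u. u \<in> {1..n} \<Longrightarrow> u \<noteq> i \<Longrightarrow> final_level pal v u = final_level pal v i \<Longrightarrow> p \<notin> v u"
proof -
  obtain K where K: "K \<subseteq> {1..<i}" "meeting v (insert i K)"
    "\<And>k. k \<in> K \<Longrightarrow> final_level pal v k < final_level pal v i"
    "final_level pal v i \<le> card K + 1"
    using lower_level_clique[of i pal v] i by auto
  have "insert i K \<subseteq> {1..n}" using K(1) i by auto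
  then obtain p where p: "\<And>k. k \<in> insert i K \<Longrightarrow> p \<in> v k"
    using common_point[of "insert i K"] K(2) by blast
  have "p \<notin> v u" if u: "u \<in> {1..n}" "u \<noteq> i" "final_level pal v u = final_level pal v i" for u
  proof
    assume pu: "p \<in> v u"
    let ?L = "insert u (insert i K)"
    \<comment> \<open>The clique bound applies at the last arrival, and either of \<open>u\<close>
      and \<open>i\<close> may come later.\<close>
    let ?m = "max u i"
    have m: "?m \<in> {u, i}" "final_level pal v ?m = final_level pal v i"
      using u by (auto simp: max_def)
    have "meeting v ?L"
      using p pu unfolding pairwise_def by blast
    moreover have "?L \<subseteq> {1..?m}"
      using K(1) u(1) i(1) by fastforce
    moreover have "final_level pal v k \<le> final_level pal v ?m" if "k \<in> ?L" for k
      using that K(3)[of k] u(3) m(2) by auto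
    ultimately have "card ?L \<le> final_level pal v ?m"
      using m(1) by (intro meeting_card_le_final_level) auto
    \<comment> \<open>Hence \<open>?L\<close> has \<open>card K + 2\<close> members, at least one
      more than the level.\<close>
    moreover have "u \<notin> insert i K" "i \<notin> K" "finite K"
      using u(2,3) K(1) K(3)[of u] finite_subset[OF K(1)] by auto
    ultimately show False using K(4) m by simp
  qed
  moreover have "K \<noteq> {}" using K(4) i(2) by auto
  ultimately show ?thesis using that p K by blast
qed

text \<open>The intervals of \<open>u\<close> and \<open>i\<close> overlap, so their union is an
  interval. It covers that of \<open>w\<close>, leaving no room for a private point of
  \<open>w\<close>.\<close>

lemma unit_interval_between_not_private:
  assumes "i \<in> {1..n}" "u \<in> {1..n}" "w \<in> {1..n}" "u \<noteq> w" "i \<noteq> w"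
    and "2 \<le> final_level pal v w"
    and "final_level pal v u = final_level pal v w" "final_level pal v i = final_level pal v w"
    and "a u \<le> a w" "a w \<le> a i" "a i \<le> a u + 1"
  shows False
proof -
  obtain q K where q: "q \<in> v w"
    "\<And>x. x \<in> {1..n} \<Longrightarrow> x \<noteq> w \<Longrightarrow> final_level pal v x = final_level pal v w \<Longrightarrow> q \<notin> v x"
    using private_point[OF assms(3,6)] by metis
  have "q \<notin> v u" "q \<notin> v i" using q(2) assms by auto
  with q(1) assms show False by (auto simp: unit)
qed

text \<open>\<open>A\<close> and \<open>B\<close> collect the neighbours left and right of the
  private point \<open>p\<close>. Of two neighbours on one side, the one nearer to \<open>i\<close>
  would be covered by the other and \<open>i\<close>.\<close>

lemma earlier_neighbours_split:
  assumes i: "i \<in> {1..n}" "2 \<le> final_level pal v i"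
  obtains A B where "earlier_neighbours pal v i = A \<union> B" "card A \<le> 1" "card B \<le> 1"
    "final_level pal v i = 2 \<Longrightarrow> A = {} \<or> B = {}"
proof -
  let ?N = "earlier_neighbours pal v i"
  obtain p K where p: "p \<in> v i" "K \<subseteq> {1..<i}" "K \<noteq> {}"
    "\<And>k. k \<in> K \<Longrightarrow> p \<in> v k"
    "\<And>k. k \<in> K \<Longrightarrow> final_level pal v k < final_level pal v i"
    "\<And>u. u \<in> {1..n} \<Longrightarrow> u \<noteq> i \<Longrightarrow> final_level pal v u = final_level pal v i \<Longrightarrow> p \<notin> v u"
    using private_point[OF i] by metis
  have pi: "a i \<le> p" "p \<le> a i + 1" using p(1) i by (auto simp: unit)
  have N: "u \<in> {1..<i}" "u \<in> {1..n}" "u \<noteq> i" "final_level pal v u = final_level pal v i"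
    "\<bar>a u - a i\<bar> \<le> 1" "a u + 1 < p \<or> p < a u" if "u \<in> ?N" for u
  proof -
    show u: "u \<in> {1..<i}" "u \<in> {1..n}" "u \<noteq> i" "final_level pal v u = final_level pal v i"
      using that i by (auto simp: earlier_neighbours_def)
    show "\<bar>a u - a i\<bar> \<le> 1"
      using that unit_meet[OF u(2) i(1)] by (auto simp: earlier_neighbours_def)
    show "a u + 1 < p \<or> p < a u"
      using p(6)[OF u(2-4)] u(2) by (auto simp: unit)
  qed
  let ?A = "{u \<in> ?N. a u + 1 < p}" and ?B = "{u \<in> ?N. p < a u}"
  have A: "u = w" if uw: "u \<in> ?A" "w \<in> ?A" "a u \<le> a w" for u w
  proof (rule ccontr)
    assume ne: "u \<noteq> w"
    have u: "u \<in> ?N" and w: "w \<in> ?N" "a w + 1 < p" using uw by auto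
    have "a w \<le> a i" "a i \<le> a u + 1" using w(2) pi N(5)[OF u] by linarith+
    then show False
      by (intro unit_interval_between_not_private[OF i(1) N(2)[OF u] N(2)[OF w(1)] ne])
        (use N(3)[OF w(1)] N(4)[OF u] N(4)[OF w(1)] i(2) uw(3) in simp_all)
  qed
  \<comment> \<open>Mirror image: now \<open>i\<close> is the left interval, \<open>u\<close> the
    right one, and \<open>w\<close> lies between them.\<close>
  have B: "u = w" if uw: "u \<in> ?B" "w \<in> ?B" "a w \<le> a u" for u w
  proof (rule ccontr)
    assume ne: "u \<noteq> w"
    have u: "u \<in> ?N" and w: "w \<in> ?N" "p < a w" using uw by auto
    have "a i \<le> a w" "a u \<le> a i + 1" using w(2) pi N(5)[OF u] by linarith+
    then show False
      by (intro unit_interval_between_not_private[OF N(2)[OF u] i(1) N(2)[OF w(1)] _ ne])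
        (use N(3)[OF w(1)] N(4)[OF u] N(4)[OF w(1)] i(2) uw(3) in simp_all)
  qed
  have fin: "finite ?A" "finite ?B"
    by (simp_all add: finite_earlier_neighbours)
  have "card ?A \<le> 1"
    unfolding One_nat_def card_le_Suc0_iff_eq[OF fin(1)]
  proof (intro ballI)
    fix u w assume "u \<in> ?A" "w \<in> ?A"
    then show "u = w"
      using A[of u w] A[of w u] linear[of "a u" "a w"] by argo
  qed
  moreover have "card ?B \<le> 1"
    unfolding One_nat_def card_le_Suc0_iff_eq[OF fin(2)]
  proof (intro ballI)
    fix u w assume "u \<in> ?B" "w \<in> ?B"
    then show "u = w"
      using B[of u w] B[of w u] linear[of "a u" "a w"] by argo
  qed
  moreover have "?N = ?A \<union> ?B" using N by blast
  moreover have "?A = {} \<or> ?B = {}" if l2: "final_level pal v i = 2"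
  proof (rule ccontr)
    assume "\<not> ?thesis"
    then obtain u w where uw: "u \<in> ?N" "a u + 1 < p" "w \<in> ?N" "p < a w" by auto
    obtain k where k: "k \<in> K" using p(3) by auto
    have kn: "k \<in> {1..<i}" "k \<in> {1..n}" using k p(2) i by auto
    have pk: "a k \<le> p" "p \<le> a k + 1" using p(4)[OF k] kn by (auto simp: unit)
    \<comment> \<open>If \<open>k\<close> misses \<open>u\<close>, then
      \<open>a k > a u + 1 \<ge> a i\<close>. Since \<open>a k \<le> p < a w \<le> a i + 1\<close>,
      it then meets \<open>w\<close>.\<close>
    obtain x where x: "x \<in> ?N" "\<bar>a x - a k\<bar> \<le> 1"
    proof (cases "a k \<le> a u + 1")
      case True
      then show ?thesis using that[of u] uw pk by auto
    next
      case False
      then show ?thesis using that[of w] uw pk N(5)[of u] N(5)[of w] by auto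
    qed
    have "k \<noteq> x" using p(5)[OF k] N(4)[OF x(1)] by auto
    moreover have "v x \<inter> v k \<noteq> {}" "v x \<inter> v i \<noteq> {}" "v k \<inter> v i \<noteq> {}"
      using unit_meet[OF N(2)[OF x(1)] kn(2)] unit_meet[OF N(2)[OF x(1)] i(1)]
        x(2) N(5)[OF x(1)] p(1) p(4)[OF k] by auto
    \<comment> \<open>The triangle has levels at most 2 and \<open>i\<close> as its last arrival,
      contradicting level 2 of \<open>i\<close>.\<close>
    then have "card {x, k, i} \<le> final_level pal v i"
      using N(1,4)[OF x(1)] kn p(5)[OF k]
      by (intro meeting_card_le_final_level) (auto simp: pairwise_insert Int_commute)
    ultimately show False using l2 N(1)[OF x(1)] kn by simp
  qed
  ultimately show ?thesis using that by blast
qed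

text \<open>At most 0, 1 and 2 neighbours on level 1, level 2 and all higher levels, so that
  \<open>min l 3\<close> bounds the number of colors on level \<open>l\<close>.\<close>

lemma card_earlier_neighbours:
  assumes "i \<in> {1..n}"
  shows "card (earlier_neighbours pal v i) < min (final_level pal v i) 3"
proof (cases "final_level pal v i = 1")
  case True
  then show ?thesis by (simp add: earlier_neighbours_level_1)
next
  case False
  then have l: "2 \<le> final_level pal v i"
    using final_level_pos[of pal v i] by linarith
  obtain A B where AB: "earlier_neighbours pal v i = A \<union> B" "card A \<le> 1" "card B \<le> 1"
    "final_level pal v i = 2 \<Longrightarrow> A = {} \<or> B = {}"
    using earlier_neighbours_split[OF assms l] by metis
  have "card (A \<union> B) \<le> card A + card B" by (rule card_Un_le)
  then show ?thesis
    using AB l by (cases "final_level pal v i = 2") auto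
qed

end

section \<open>First-Fit\<close>

text \<open>Pigeonhole: the first \<open>card N + 1\<close> colors are distinct, and
  \<open>N\<close> blocks at most \<open>card N\<close> of them.\<close>

lemma Least_color_le_card:
  fixes p :: "nat \<Rightarrow> 'c"
  assumes "inj p" "finite N"
  shows "(LEAST k. \<forall>j\<in>N. col j \<noteq> p k) \<le> card N"
proof -
  have "\<exists>k\<le>card N. (\<forall>j\<in>N. col j \<noteq> p k)"
  proof (rule ccontr)
    assume "\<not> ?thesis"
    then have "p ` {..card N} \<subseteq> col ` N" by force
    then have "card (p ` {..card N}) \<le> card (col ` N)"
      using assms by (intro card_mono) auto
    also have "\<dots> \<le> card N" using assms(2) by (rule card_image_le)
    finally show False
      using assms by (simp add: card_image inj_on_subset[OF assms(1)])
  qed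
  then obtain k where k: "k \<le> card N" "\<forall>j\<in>N. col j \<noteq> p k" by blast
  have "(LEAST k. \<forall>j\<in>N. col j \<noteq> p k) \<le> k"
    using k(2) by (rule Least_le)
  with k(1) show ?thesis by simp
qed

text \<open>Frees the coloring rule from the intermediate states: the colors it consults are already
  final.\<close>

lemma final_color_First_Fit:
  assumes "1 \<le> i"
  shows "final_color pal v i = pal (final_level pal v i)
    (LEAST k. \<forall>j\<in>earlier_neighbours pal v i. final_color pal v j \<noteq> pal (final_level pal v i) k)"
proof -
  obtain m where m: "i = Suc m"
    using assms by (cases i) auto
  let ?l = "final_level pal v i"
  \<comment> \<open>First-Fit runs on the graph taken after the new level of \<open>i\<close> has
    been recorded.\<close>
  let ?lev = "(fst (kt_state pal v m))(i := ?l)"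
  have lv: "level_verts ?lev ?l ?l i = {j \<in> {1..i}. final_level pal v j = ?l}"
    by (auto simp: level_verts_def fst_kt_state m)
  have N: "j \<in> fst (level_graph v ?lev ?l ?l i) \<and> j < i \<and> {j, i} \<in> snd (level_graph v ?lev ?l ?l i)
      \<longleftrightarrow> j \<in> earlier_neighbours pal v i" for j
    unfolding fst_level_graph level_graph_edge lv using assms
    by (auto simp: earlier_neighbours_def)
  have "final_color pal v i =
      first_fit (level_graph v ?lev ?l ?l i) (pal ?l) (snd (kt_state pal v m)) i"
    by (simp add: final_color_def m final_level_Suc Let_def split_beta)
  also have "\<dots> = pal ?l (LEAST k. \<forall>j\<in>earlier_neighbours pal v i. snd (kt_state pal v m) j \<noteq> pal ?l k)"
    unfolding first_fit_def Ball_def using N by (metis (no_types, lifting))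
  also have "\<dots> = pal ?l (LEAST k. \<forall>j\<in>earlier_neighbours pal v i. final_color pal v j \<noteq> pal ?l k)"
    using m by (simp add: snd_kt_state earlier_neighbours_def cong: ball_cong)
  finally show ?thesis .
qed

text \<open>Clique number at least 2 excludes nonempty inputs without edges, where one color is used
  but \<open>3 * 1 - 3\<close> is 0.\<close>

theorem theorem1:
  fixes pal :: "nat \<Rightarrow> nat \<Rightarrow> 'c" and v :: "nat \<Rightarrow> real set" and n :: nat
  assumes "palettes pal"
    and "\<And>i. i \<in> {1..n} \<Longrightarrow> unit_interval (v i)"
    and "clique_number (interval_graph v n) \<ge> 2"
  shows "card (kt_colors_used pal v n) \<le> 3 * clique_number (interval_graph v n) - 3"
proof -
  let ?w = "clique_number (interval_graph v n)"
  obtain a where a: "\<And>i. i \<in> {1..n} \<Longrightarrow> v i = {a i..a i + 1}"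
    using assms(2) unfolding unit_interval_def by metis
  \<comment> \<open>Every color is among the first \<open>min l 3\<close> of some palette
    \<open>l\<close> up to the clique number; it remains to count these.\<close>
  have "final_color pal v i \<in> (\<Union>l\<in>{1..?w}. pal l ` {..<min l 3})" if i: "i \<in> {1..n}" for i
  proof -
    let ?l = "final_level pal v i"
    have "?l \<in> {1..?w}"
      using final_level_pos[of pal v i] final_level_le_clique_number[OF i, of pal v] by simp
    moreover from this have inj: "inj (pal ?l)"
      using assms(1) by (simp add: palettes_def)
    have "card (earlier_neighbours pal v i) < min ?l 3"
      using a i by (rule card_earlier_neighbours)
    with Least_color_le_card[OF inj finite_earlier_neighbours]
    have "(LEAST k. \<forall>j\<in>earlier_neighbours pal v i. final_color pal v j \<noteq> pal ?l k) < min ?l 3"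
      by (rule le_less_trans)
    then have "final_color pal v i \<in> pal ?l ` {..<min ?l 3}"
      using i by (subst final_color_First_Fit) (simp, blast)
    ultimately show ?thesis by blast
  qed
  then have "kt_colors_used pal v n \<subseteq> (\<Union>l\<in>{1..?w}. pal l ` {..<min l 3})"
    by (auto simp: kt_colors_used_def snd_kt_state)
  then have "card (kt_colors_used pal v n) \<le> card (\<Union>l\<in>{1..?w}. pal l ` {..<min l 3})"
    by (rule card_mono[rotated]) auto
  also have "\<dots> \<le> (\<Sum>l\<in>{1..?w}. card (pal l ` {..<min l 3}))"
    by (rule card_UN_le) simp
  also have "\<dots> \<le> (\<Sum>l\<in>{1..?w}. min l 3)"
    by (rule sum_mono) (metis card_image_le card_lessThan finite_lessThan)
  also have "\<dots> = 3 * ?w - 3"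
  proof -
    \<comment> \<open>The base case is \<open>1 + 2 = 3 * 2 - 3\<close>; each further level is at
      least 3 and adds 3.\<close>
    have "(\<Sum>l\<in>{1..w}. min l 3) = 3 * w - 3" if "2 \<le> w" for w :: nat
      using that by (induction w rule: dec_induct) (simp_all add: numeral_2_eq_2)
    then show ?thesis using assms(3) by blast
  qed
  finally show ?thesis .
qed

end
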